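(* Let $G=(V,E)$ be a finite, connected multigraph with no self-loops and with at least one edge. Then $G$ admits a homogeneous core, i.e., there is a connected vertex-induced subgraph $H$ of $G$ such that $H$ has at least one edge, every fair tree $\gamma\in\Gamma_G$ restricts to a spanning tree of $H$ (that is, $\gamma\cap E_H$ is a spanning tree of $H$), and $H$ is itself a homogeneous graph.
   Context: Multigraphs may have parallel edges but no self-loops. For a finite connected multigraph $G=(V,E)$, $\Gamma_G$ is the set of spanning trees of $G$, each regarded as a subset of $E$; $\mathcal{P}(\Gamma_G)$ is the set of probability mass functions (pmfs) on $\Gamma_G$. The minimum expected overlap is $\mathrm{MEO}(\Gamma_G)=\min_{\mu\in\mathcal{P}(\Gamma_G)}\sum_{\gamma,\gamma'\in\Gamma_G}|\gamma\cap\gamma'|\,\mu(\gamma)\mu(\gamma')$, and a pmf attaining the minimum is called optimal. The edge usage probabilities $\eta^*(e)=\sum_{\gamma\ni e}\mu^*(\gamma)$, $e\in E$, are the same for every optimal pmf $\mu^*$. $G$ is called homogeneous if $\eta^*$ is constant on $E$. A spanning tree $\gamma$ is called fair if $\mu^*(\gamma)>0$ for some optimal pmf $\mu^*$. A subgraph $H=(V_H,E_H)$ is vertex-induced if every edge of $G$ with both endpoints in $V_H$ belongs to $E_H$. A homogeneous core of $G$ is a connected subgraph $H$ which (1) has at least one edge, (2) has the restriction property: $\gamma\cap E_H$ is a spanning tree of $H$ for every fair tree $\gamma$ of $G$, (3) is a vertex-induced subgraph of $G$, and (4) is itself a homogeneous graph. *)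

theory Defs
  imports "HOL-Probability.Probability_Mass_Function"
begin

record ('v, 'e) multigraph =
  verts :: "'v set"
  edges :: "'e set"
  ends :: "'e \<Rightarrow> 'v set"

text \<open>Several edges may have the same set of ends (parallel edges), but an edge always has two
  distinct ends (no self-loops).\<close>

definition finite_multigraph :: "('v, 'e) multigraph \<Rightarrow> bool" where
  "finite_multigraph G \<longleftrightarrow> finite (verts G) \<and> finite (edges G) \<and>
     (\<forall>e\<in>edges G. ends G e \<subseteq> verts G \<and> card (ends G e) = 2)"

fun walk :: "('v, 'e) multigraph \<Rightarrow> 'v \<Rightarrow> 'e list \<Rightarrow> 'v \<Rightarrow> bool" where
  "walk G u [] v \<longleftrightarrow> u \<in> verts G \<and> u = v"
| "walk G u (e # es) v \<longleftrightarrow> e \<in> edges G \<and> (\<exists>w. ends G e = {u, w} \<and> walk G w es v)"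

definition graph_connected :: "('v, 'e) multigraph \<Rightarrow> bool" where
  "graph_connected G \<longleftrightarrow>
     verts G \<noteq> {} \<and> (\<forall>u\<in>verts G. \<forall>v\<in>verts G. \<exists>es. walk G u es v)"

text \<open>The edges of a cycle are required to be distinct, so a pair of parallel edges is a cycle
  of length two, whereas traversing one edge back and forth is not.\<close>

definition graph_cycle :: "('v, 'e) multigraph \<Rightarrow> 'v list \<Rightarrow> 'e list \<Rightarrow> bool" where
  "graph_cycle G vs es \<longleftrightarrow>
     length vs = length es \<and> length es \<ge> 2 \<and> distinct vs \<and> distinct es \<and> set es \<subseteq> edges G \<and>
     (\<forall>i<length es. ends G (es ! i) = {vs ! i, vs ! (Suc i mod length es)})"

definition graph_tree :: "('v, 'e) multigraph \<Rightarrow> bool" where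
  "graph_tree G \<longleftrightarrow> graph_connected G \<and> (\<nexists>vs es. graph_cycle G vs es)"

definition spanning_trees :: "('v, 'e) multigraph \<Rightarrow> 'e set set" where
  "spanning_trees G = {\<gamma>. \<gamma> \<subseteq> edges G \<and> graph_tree (G\<lparr>edges := \<gamma>\<rparr>)}"

definition tree_pmfs :: "('v, 'e) multigraph \<Rightarrow> 'e set pmf set" where
  "tree_pmfs G = {\<mu>. set_pmf \<mu> \<subseteq> spanning_trees G}"

definition expected_overlap :: "('v, 'e) multigraph \<Rightarrow> 'e set pmf \<Rightarrow> real" where
  "expected_overlap G \<mu> =
     (\<Sum>\<gamma>\<in>spanning_trees G. \<Sum>\<gamma>'\<in>spanning_trees G.
        real (card (\<gamma> \<inter> \<gamma>')) * pmf \<mu> \<gamma> * pmf \<mu> \<gamma>')"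

definition MEO :: "('v, 'e) multigraph \<Rightarrow> real" where
  "MEO G = (INF \<mu>\<in>tree_pmfs G. expected_overlap G \<mu>)"

definition optimal_pmf :: "('v, 'e) multigraph \<Rightarrow> 'e set pmf \<Rightarrow> bool" where
  "optimal_pmf G \<mu> \<longleftrightarrow> \<mu> \<in> tree_pmfs G \<and> expected_overlap G \<mu> = MEO G"

definition edge_usage :: "('v, 'e) multigraph \<Rightarrow> 'e set pmf \<Rightarrow> 'e \<Rightarrow> real" where
  "edge_usage G \<mu> e = (\<Sum>\<gamma> | \<gamma> \<in> spanning_trees G \<and> e \<in> \<gamma>. pmf \<mu> \<gamma>)"

text \<open>The usage probabilities of a finite connected multigraph do not depend on the choice of the
  optimal pmf.  The definition does not rely on this: it asks that an optimal pmf exists and that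
  all of them have the same constant usage.\<close>

definition homogeneous :: "('v, 'e) multigraph \<Rightarrow> bool" where
  "homogeneous G \<longleftrightarrow> (\<exists>\<mu>. optimal_pmf G \<mu>) \<and>
     (\<exists>c. \<forall>\<mu>. optimal_pmf G \<mu> \<longrightarrow> (\<forall>e\<in>edges G. edge_usage G \<mu> e = c))"

definition fair_tree :: "('v, 'e) multigraph \<Rightarrow> 'e set \<Rightarrow> bool" where
  "fair_tree G \<gamma> \<longleftrightarrow> \<gamma> \<in> spanning_trees G \<and> (\<exists>\<mu>. optimal_pmf G \<mu> \<and> pmf \<mu> \<gamma> > 0)"

definition subgraph :: "('v, 'e) multigraph \<Rightarrow> ('v, 'e) multigraph \<Rightarrow> bool" where
  "subgraph H G \<longleftrightarrow> finite_multigraph H \<and> verts H \<subseteq> verts G \<and> edges H \<subseteq> edges G \<and>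
     (\<forall>e\<in>edges H. ends H e = ends G e)"

definition vertex_induced :: "('v, 'e) multigraph \<Rightarrow> ('v, 'e) multigraph \<Rightarrow> bool" where
  "vertex_induced H G \<longleftrightarrow> (\<forall>e\<in>edges G. ends G e \<subseteq> verts H \<longrightarrow> e \<in> edges H)"

definition homogeneous_core :: "('v, 'e) multigraph \<Rightarrow> ('v, 'e) multigraph \<Rightarrow> bool" where
  "homogeneous_core H G \<longleftrightarrow>
     subgraph H G \<and> graph_connected H \<and>
     edges H \<noteq> {} \<and>
     (\<forall>\<gamma>. fair_tree G \<gamma> \<longrightarrow> \<gamma> \<inter> edges H \<in> spanning_trees H) \<and>
     vertex_induced H G \<and>
     homogeneous H"

end

theory Submission
  imports Defs
begin

text \<open>
  The expected overlap of a distribution on spanning trees is the squared Euclidean norm of its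
  vector of edge usage probabilities. An optimal distribution exists by compactness, and the
  optimal usage vector \<open>\<eta>\<close> is the unique shortest one. The first-order condition at
  the shortest vector says that every fair tree is a minimum-weight spanning tree for the edge
  weights \<open>\<eta>\<close> (\<open>fair_tree_minimizes_usage\<close>).

  Let \<open>m\<close> be the smallest value of \<open>\<eta>\<close>. The core \<open>H\<close> is a nontrivial connected component of
  the graph formed by the edges of weight \<open>m\<close>. Minimum-weight spanning trees behave
  greedily: they span the lightest edges by lightest edges, and thus restrict to spanning trees of \<open>H\<close>
  (\<open>minimum_weight_basis_restricts\<close>). This is the restriction property.

  The other two properties follow from it. An edge that joins two vertices of \<open>H\<close> but is not in \<open>H\<close> has
  weight larger than \<open>m \<ge> 0\<close>, so some fair tree contains it; but the restriction of this tree to \<open>H\<close>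
  already connects its ends, so there would be a cycle. Hence \<open>H\<close> is induced. Restricting a random
  optimal tree to \<open>H\<close> gives a random spanning tree of \<open>H\<close> that uses every edge with the same probability \<open>m\<close>.
  Since all spanning trees of \<open>H\<close> have equally many edges, all usage vectors of \<open>H\<close> have the same
  coordinate sum, and the constant vector is the unique shortest one among them
  (\<open>homogeneous_if_constant_usage\<close>). Hence \<open>H\<close> is homogeneous.

  The graph theory is done in the graphic matroid. Spanning trees are its bases
  (\<open>spanning_trees_eq_bases\<close>), and the exchange property of its closure operator gives both the
  swapping of edges and the equal size of all spanning trees.
\<close>

section \<open>The closure operator of the graphic matroid\<close>

definition linked :: "('e \<Rightarrow> 'v set) \<Rightarrow> 'e set \<Rightarrow> 'v \<Rightarrow> 'v \<Rightarrow> bool" where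
  "linked d F = (\<lambda>u v. \<exists>e\<in>F. d e = {u, v})\<^sup>*\<^sup>*"

definition graphic_closure :: "('e \<Rightarrow> 'v set) \<Rightarrow> 'e set \<Rightarrow> 'e set" where
  "graphic_closure d F = {e. \<exists>u v. d e = {u, v} \<and> linked d F u v}"

text \<open>The bases of the graphic matroid on the edge set \<^term>\<open>E\<close>. Independence is stated as absence of
  edges that are spanned by the others, so that cycles never appear in the exchange arguments.\<close>
definition graphic_basis :: "('e \<Rightarrow> 'v set) \<Rightarrow> 'e set \<Rightarrow> 'e set \<Rightarrow> bool" where
  "graphic_basis d E B \<longleftrightarrow>
     B \<subseteq> E \<and> E \<subseteq> graphic_closure d B \<and> (\<forall>e\<in>B. e \<notin> graphic_closure d (B - {e}))"

lemma linked_refl [simp]: "linked d F u u"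
  by (simp add: linked_def)

lemma linked_trans: "linked d F u v \<Longrightarrow> linked d F v w \<Longrightarrow> linked d F u w"
  unfolding linked_def by (rule rtranclp_trans)

lemma linked_edge: "e \<in> F \<Longrightarrow> d e = {u, v} \<Longrightarrow> linked d F u v"
  unfolding linked_def by blast

lemma linked_induct [consumes 1, case_names refl step]:
  assumes "linked d F u v" and "P u"
    and "\<And>v w e. linked d F u v \<Longrightarrow> P v \<Longrightarrow> e \<in> F \<Longrightarrow> d e = {v, w} \<Longrightarrow> P w"
  shows "P v"
  using assms unfolding linked_def by (induction rule: rtranclp_induct) blast+

lemma linked_sym: "linked d F u v \<Longrightarrow> linked d F v u"
proof (induction rule: linked_induct)
  case refl
  show ?case by simp
next
  case (step v w e)
  have "linked d F w v"
    using step.hyps by (intro linked_edge[of e]) auto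
  then show ?case
    using step.IH by (rule linked_trans)
qed

lemma linked_mono:
  assumes "F \<subseteq> F'" and "linked d F u v"
  shows "linked d F' u v"
  using assms(2)
proof (induction rule: linked_induct)
  case (step v w e)
  then show ?case
    using assms(1) by (meson linked_edge linked_trans subsetD)
qed simp

lemma graphic_closure_iff:
  assumes "d e = {u, v}"
  shows "e \<in> graphic_closure d F \<longleftrightarrow> linked d F u v"
  using assms by (auto simp: graphic_closure_def doubleton_eq_iff intro: linked_sym)

lemma graphic_closure_mono: "F \<subseteq> F' \<Longrightarrow> graphic_closure d F \<subseteq> graphic_closure d F'"
  unfolding graphic_closure_def by (blast intro: linked_mono)

lemma linked_of_subset_closure:
  assumes "F \<subseteq> graphic_closure d S" and "linked d F u v"
  shows "linked d S u v"
  using assms(2)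
proof (induction rule: linked_induct)
  case (step v w e)
  then have "linked d S v w"
    using assms(1) graphic_closure_iff by (metis subsetD)
  with step.IH show ?case
    by (rule linked_trans)
qed simp

lemma graphic_closure_least:
  "F \<subseteq> graphic_closure d S \<Longrightarrow> graphic_closure d F \<subseteq> graphic_closure d S"
  using linked_of_subset_closure unfolding graphic_closure_def by fastforce

text \<open>A route that uses the new edge can be cut at its first and last use of it, which leaves three
  possibilities: the edge is avoided, or is traversed in one of its two directions.\<close>
lemma linked_insert:
  assumes "linked d (insert f S) u v" and f: "d f = {x, y}"
  shows "linked d S u v \<or> linked d S u x \<and> linked d S y v \<or> linked d S u y \<and> linked d S x v"
  using assms(1)
proof (induction rule: linked_induct)
  case (step v w e)
  show ?case
  proof (cases "e = f")
    case True
    with step.hyps f have "v = x \<and> w = y \<or> v = y \<and> w = x"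
      by (auto simp: doubleton_eq_iff)
    with step.IH show ?thesis
      by (auto intro: linked_sym linked_trans)
  next
    case False
    with step.hyps have "linked d S v w"
      by (auto intro: linked_edge)
    with step.IH show ?thesis
      by (blast intro: linked_trans)
  qed
qed simp

text \<open>The MacLane--Steinitz exchange axiom. A connection between the ends of \<^term>\<open>e\<close> that needs \<^term>\<open>f\<close>
  consists of two pieces avoiding \<^term>\<open>f\<close>, from the ends of \<^term>\<open>e\<close> to the ends of \<^term>\<open>f\<close>; closing them
  up with \<^term>\<open>e\<close> joins the ends of \<^term>\<open>f\<close>.\<close>
lemma graphic_closure_exchange:
  assumes f: "d f = {x, y}"
    and "e \<in> graphic_closure d (insert f S)" and "e \<notin> graphic_closure d S"
  shows "f \<in> graphic_closure d (insert e S)"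
proof -
  obtain u v where e: "d e = {u, v}" and uv: "linked d (insert f S) u v"
    using assms(2) by (auto simp: graphic_closure_def)
  have "\<not> linked d S u v"
    using assms(3) e by (simp add: graphic_closure_iff)
  with linked_insert[OF uv f]
  have "linked d S u x \<and> linked d S y v \<or> linked d S u y \<and> linked d S x v"
    by blast
  then have *: "linked d (insert e S) u x \<and> linked d (insert e S) y v \<or>
      linked d (insert e S) u y \<and> linked d (insert e S) x v"
    by (meson linked_mono subset_insertI)
  have "linked d (insert e S) u v"
    using e by (auto intro: linked_edge)
  with * have "linked d (insert e S) x y"
    by (meson linked_sym linked_trans)
  with f show ?thesis
    by (simp add: graphic_closure_iff)
qed

text \<open>For a forest \<^term>\<open>B\<close> the set \<^term>\<open>P\<close> is the path between the ends of \<^term>\<open>e\<close>, that is, the fundamental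
  cycle of \<^term>\<open>e\<close> without \<^term>\<open>e\<close>. Minimality replaces any bookkeeping with paths.\<close>
lemma minimal_subset_with_closure:
  assumes "finite B" and "e \<in> graphic_closure d B"
  obtains P where "P \<subseteq> B" and "e \<in> graphic_closure d P"
    and "\<And>f. f \<in> P \<Longrightarrow> e \<notin> graphic_closure d (P - {f})"
proof -
  let ?A = "{P. P \<subseteq> B \<and> e \<in> graphic_closure d P}"
  have "finite ?A" "?A \<noteq> {}"
    using assms by auto
  then obtain P where P: "P \<in> ?A" "\<And>Q. Q \<in> ?A \<Longrightarrow> Q \<subseteq> P \<Longrightarrow> P = Q"
    by (meson finite_has_minimal)
  have "e \<notin> graphic_closure d (P - {f})" if "f \<in> P" for f
  proof
    assume "e \<in> graphic_closure d (P - {f})"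
    then have "P = P - {f}"
      using P(1) by (intro P(2)) auto
    with that show False by blast
  qed
  with P(1) show ?thesis
    by (intro that[of P]) auto
qed

text \<open>By the exchange axiom \<^term>\<open>f\<close> lies in the closure of the new set, which therefore spans everything
  that \<^term>\<open>B\<close> spans. If the new set had a redundant edge, a second exchange would make \<^term>\<open>f\<close> redundant
  in \<^term>\<open>B\<close>.\<close>
lemma graphic_basis_swap:
  assumes B: "graphic_basis d E B" and "e \<in> E"
    and P: "P \<subseteq> B" "e \<in> graphic_closure d P" "e \<notin> graphic_closure d (P - {f})"
    and "f \<in> P" and f: "d f = {x, y}"
  shows "graphic_basis d E (insert e (B - {f}))"
proof -
  have indep: "g \<notin> graphic_closure d (B - {g})" if "g \<in> B" for g
    using B that by (simp add: graphic_basis_def)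
  have "insert f (P - {f}) = P"
    using \<open>f \<in> P\<close> by blast
  then have "f \<in> graphic_closure d (insert e (P - {f}))"
    using P f by (intro graphic_closure_exchange[of d f x y e]) auto
  moreover have "insert e (P - {f}) \<subseteq> insert e (B - {f})"
    using P(1) by blast
  ultimately have f_in: "f \<in> graphic_closure d (insert e (B - {f}))"
    using graphic_closure_mono by blast
  have sub: "F \<subseteq> graphic_closure d F" if "F \<subseteq> E" for F
  proof
    fix g assume "g \<in> F"
    then have "g \<in> graphic_closure d B"
      using B that by (auto simp: graphic_basis_def)
    then obtain u v where "d g = {u, v}"
      by (auto simp: graphic_closure_def)
    with \<open>g \<in> F\<close> show "g \<in> graphic_closure d F"
      by (auto simp: graphic_closure_iff intro: linked_edge)
  qed
  have BE: "B \<subseteq> E"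
    using B by (simp add: graphic_basis_def)
  then have "insert e (B - {f}) \<subseteq> E"
    using \<open>e \<in> E\<close> by blast
  note sub' = sub[OF this]
  have "B \<subseteq> graphic_closure d (insert e (B - {f}))"
    using f_in sub' by blast
  then have spans: "E \<subseteq> graphic_closure d (insert e (B - {f}))"
    using B graphic_closure_least unfolding graphic_basis_def by blast
  \<comment> \<open>Otherwise \<^term>\<open>B - {f}\<close> would span the new set and with it \<^term>\<open>f\<close>.\<close>
  have e_notin: "e \<notin> graphic_closure d (B - {f})"
  proof
    assume "e \<in> graphic_closure d (B - {f})"
    then have "insert e (B - {f}) \<subseteq> graphic_closure d (B - {f})"
      using sub[of "B - {f}"] BE by blast
    then have "f \<in> graphic_closure d (B - {f})"
      using f_in graphic_closure_least by blast
    then show False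
      using indep P(1) \<open>f \<in> P\<close> by blast
  qed
  have "g \<notin> graphic_closure d (insert e (B - {f}) - {g})" if g: "g \<in> insert e (B - {f})" for g
  proof (cases "g = e")
    case True
    have "insert e (B - {f}) - {e} \<subseteq> B - {f}" by blast
    with True e_notin show ?thesis
      using graphic_closure_mono by blast
  next
    case False
    then have gB: "g \<in> B" "g \<noteq> f"
      using g by auto
    \<comment> \<open>A redundant \<^term>\<open>g\<close> depends on \<^term>\<open>e\<close>, as \<^term>\<open>B\<close> is independent; by exchange \<^term>\<open>e\<close> is then spanned by \<^term>\<open>B - {f}\<close>.\<close>
    define S where "S = B - {f} - {g}"
    have eq: "insert e (B - {f}) - {g} = insert e S" "insert g S = B - {f}"
      using False gB by (auto simp: S_def)
    obtain a b where e: "d e = {a, b}"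
      using P(2) by (auto simp: graphic_closure_def)
    have "g \<notin> graphic_closure d S"
      using indep[OF gB(1)] graphic_closure_mono[of S "B - {g}"] by (auto simp: S_def)
    then show ?thesis
      using graphic_closure_exchange[of d e a b g S] e e_notin eq by auto
  qed
  with spans \<open>insert e (B - {f}) \<subseteq> E\<close> show ?thesis
    by (simp add: graphic_basis_def)
qed

text \<open>As long as some \<^term>\<open>e\<close> of \<^term>\<open>C\<close> is missing from \<^term>\<open>B\<close>, the fundamental cycle of \<^term>\<open>e\<close> cannot stay
  inside \<^term>\<open>C\<close>, so \<^term>\<open>e\<close> can be swapped for an edge outside \<^term>\<open>C\<close>. This keeps the cardinality and
  brings \<^term>\<open>B\<close> closer to \<^term>\<open>C\<close>; a basis that contains \<^term>\<open>C\<close> must equal it.\<close>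
lemma card_graphic_basis_unique:
  assumes "finite E" and "graphic_basis d E B" and "graphic_basis d E C"
  shows "card B = card C"
  using assms(2)
proof (induction "card (C - B)" arbitrary: B rule: less_induct)
  case less
  have fin: "finite B" "finite C"
    using assms less.prems finite_subset by (auto simp: graphic_basis_def)
  show ?case
  proof (cases "C \<subseteq> B")
    case True
    have "e \<in> C" if "e \<in> B" for e
    proof (rule ccontr)
      assume "e \<notin> C"
      then have "C \<subseteq> B - {e}"
        using True by blast
      moreover have "e \<in> graphic_closure d C"
        using assms(3) less.prems that by (auto simp: graphic_basis_def)
      ultimately show False
        using less.prems that graphic_closure_mono by (fastforce simp: graphic_basis_def)
    qed
    with True show ?thesis
      by (metis subsetI subset_antisym)
  next
    case False
    then obtain e where e: "e \<in> C" "e \<notin> B"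
      by blast
    then have "e \<in> E" "e \<in> graphic_closure d B"
      using less.prems assms(3) by (auto simp: graphic_basis_def)
    then obtain P where P: "P \<subseteq> B" "e \<in> graphic_closure d P"
        "\<And>f. f \<in> P \<Longrightarrow> e \<notin> graphic_closure d (P - {f})"
      using minimal_subset_with_closure[OF fin(1)] by metis
    have "\<not> P \<subseteq> C"
    proof
      assume "P \<subseteq> C"
      then have "P \<subseteq> C - {e}"
        using P(1) e by blast
      then show False
        using P(2) e(1) assms(3) graphic_closure_mono by (fastforce simp: graphic_basis_def)
    qed
    then obtain f where f: "f \<in> P" "f \<notin> C"
      by blast
    moreover have "f \<in> graphic_closure d B"
      using f P(1) less.prems by (auto simp: graphic_basis_def)
    then obtain x y where "d f = {x, y}"
      by (auto simp: graphic_closure_def)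
    ultimately have B': "graphic_basis d E (insert e (B - {f}))"
      using graphic_basis_swap[OF less.prems \<open>e \<in> E\<close> P(1,2)] P(3) by blast
    have "C - insert e (B - {f}) \<subset> C - B"
      using e f by blast
    then have "card (C - insert e (B - {f})) < card (C - B)"
      using fin by (intro psubset_card_mono) auto
    from less.hyps[OF this B'] have "card (insert e (B - {f})) = card C" .
    moreover have "card (insert e (B - {f})) = card B"
      using e f P(1) fin by (metis Diff_iff card.remove card_insert_disjoint finite_Diff subsetD)
    ultimately show ?thesis by simp
  qed
qed

text \<open>A spanning edge set that is minimal under inclusion is a basis.\<close>
lemma graphic_basis_exists:
  assumes "finite E" and d: "\<And>e. e \<in> E \<Longrightarrow> \<exists>u v. d e = {u, v}"
  shows "\<exists>B. graphic_basis d E B"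
proof -
  have sub: "F \<subseteq> graphic_closure d F" if "F \<subseteq> E" for F
    using that d by (force simp: graphic_closure_def intro: linked_edge)
  let ?A = "{F. F \<subseteq> E \<and> E \<subseteq> graphic_closure d F}"
  have "finite ?A" "?A \<noteq> {}"
    using assms(1) sub by auto
  then obtain B where B: "B \<in> ?A" "\<And>Q. Q \<in> ?A \<Longrightarrow> Q \<subseteq> B \<Longrightarrow> B = Q"
    by (meson finite_has_minimal)
  have "e \<notin> graphic_closure d (B - {e})" if "e \<in> B" for e
  proof
    assume "e \<in> graphic_closure d (B - {e})"
    then have "B \<subseteq> graphic_closure d (B - {e})"
      using sub[of "B - {e}"] B(1) by blast
    then have "E \<subseteq> graphic_closure d (B - {e})"
      using B(1) graphic_closure_least by blast
    then have "B = B - {e}"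
      using B(1) by (intro B(2)) auto
    with that show False by blast
  qed
  with B(1) show ?thesis
    by (auto simp: graphic_basis_def)
qed

section \<open>Spanning trees are the bases of the graphic matroid\<close>

lemma walk_imp_linked:
  "walk G u es v \<Longrightarrow> linked (ends G) (edges G) u v"
proof (induction es arbitrary: u)
  case (Cons e es)
  then obtain w where "e \<in> edges G" "ends G e = {u, w}" "linked (ends G) (edges G) w v"
    by auto
  then show ?case
    by (blast intro: linked_trans linked_edge)
qed simp

lemma walk_snoc:
  assumes "walk G u es v" and "e \<in> edges G" and "ends G e = {v, w}" and "w \<in> verts G"
  shows "walk G u (es @ [e]) w"
  using assms(1)
proof (induction es arbitrary: u)
  case Nil
  then show ?case using assms by auto
qed auto

lemma linked_imp_walk:
  assumes "\<And>e. e \<in> edges G \<Longrightarrow> ends G e \<subseteq> verts G" and "u \<in> verts G"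
    and "linked (ends G) (edges G) u v"
  shows "\<exists>es. walk G u es v"
  using assms(3)
proof (induction rule: linked_induct)
  case refl
  show ?case using assms(2) by (intro exI[of _ "[]"]) simp
next
  case (step v w e)
  moreover have "w \<in> verts G"
    using step.hyps assms(1)[of e] by auto
  ultimately show ?case
    by (blast intro: walk_snoc)
qed

lemma graph_connected_iff_linked:
  assumes "\<And>e. e \<in> edges G \<Longrightarrow> ends G e \<subseteq> verts G"
  shows "graph_connected G \<longleftrightarrow>
    verts G \<noteq> {} \<and> (\<forall>u\<in>verts G. \<forall>v\<in>verts G. linked (ends G) (edges G) u v)"
  unfolding graph_connected_def using walk_imp_linked linked_imp_walk[OF assms] by metis

text \<open>The rest of a cycle leads from one end of its first edge to the other; the edges are distinct,
  so this detour avoids the first edge.\<close>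
lemma cycle_edge_in_closure:
  assumes "graph_cycle G vs es"
  shows "es ! 0 \<in> graphic_closure (ends G) (edges G - {es ! 0})"
proof -
  let ?n = "length es" and ?F = "edges G - {es ! 0}"
  have cyc: "?n \<ge> 2" "distinct es" "set es \<subseteq> edges G"
      "\<And>i. i < ?n \<Longrightarrow> ends G (es ! i) = {vs ! i, vs ! (Suc i mod ?n)}"
    using assms by (auto simp: graph_cycle_def)
  have in_F: "es ! i \<in> ?F" if "0 < i" "i < ?n" for i
    using that cyc(3) nth_eq_iff_index_eq[OF cyc(2), of i 0] by fastforce
  have "linked (ends G) ?F (vs ! 1) (vs ! Suc i)" if "Suc i < ?n" for i
    using that
  proof (induction i)
    case (Suc i)
    have "linked (ends G) ?F (vs ! Suc i) (vs ! Suc (Suc i))"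
      using Suc.prems in_F[of "Suc i"] cyc(4)[of "Suc i"] by (intro linked_edge[of "es ! Suc i"]) auto
    with Suc show ?case
      by (metis Suc_lessD linked_trans)
  qed simp
  from this[of "?n - 2"] have "linked (ends G) ?F (vs ! 1) (vs ! (?n - 1))"
    using cyc(1) by (simp add: numeral_2_eq_2 Suc_diff_Suc)
  moreover have "linked (ends G) ?F (vs ! (?n - 1)) (vs ! 0)"
  proof (rule linked_edge)
    show "es ! (?n - 1) \<in> ?F"
      using cyc(1) by (intro in_F) auto
    have "Suc (?n - 1) mod ?n = 0"
      using cyc(1) by (metis Suc_diff_1 less_le_trans mod_self pos2)
    then show "ends G (es ! (?n - 1)) = {vs ! (?n - 1), vs ! 0}"
      using cyc(1) cyc(4)[of "?n - 1"] by simp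
  qed
  ultimately have "linked (ends G) ?F (vs ! 0) (vs ! 1)"
    by (blast intro: linked_trans linked_sym)
  moreover have "ends G (es ! 0) = {vs ! 0, vs ! 1}"
    using cyc(1) cyc(4)[of 0] by force
  ultimately show ?thesis
    by (simp add: graphic_closure_iff)
qed

text \<open>A path is extended edge by edge. When the new vertex has been visited before, the path is cut
  back to that visit instead, which keeps the vertices distinct.\<close>
lemma linked_imp_simple_path:
  assumes "linked d F u v"
  shows "\<exists>vs es. length vs = Suc (length es) \<and> distinct vs \<and> set es \<subseteq> F \<and>
    (\<forall>i<length es. d (es ! i) = {vs ! i, vs ! Suc i}) \<and> vs ! 0 = u \<and> vs ! length es = v"
  using assms
proof (induction rule: linked_induct)
  case refl
  show ?case by (intro exI[of _ "[u]"] exI[of _ "[]"]) simp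
next
  case (step v w e)
  then obtain vs es where p: "length vs = Suc (length es)" "distinct vs" "set es \<subseteq> F"
      "\<And>i. i < length es \<Longrightarrow> d (es ! i) = {vs ! i, vs ! Suc i}" "vs ! 0 = u" "vs ! length es = v"
    by blast
  show ?case
  proof (cases "w \<in> set vs")
    case True
    then obtain k where k: "k < length vs" "vs ! k = w"
      by (auto simp: in_set_conv_nth)
    have "set (take k es) \<subseteq> F"
      using p(3) set_take_subset by fast
    with p k show ?thesis
      by (intro exI[of _ "take (Suc k) vs"] exI[of _ "take k es"]) auto
  next
    case False
    then show ?thesis
      using p step.hyps
      by (intro exI[of _ "vs @ [w]"] exI[of _ "es @ [e]"]) (auto simp: nth_append less_Suc_eq)
  qed
qed

text \<open>A simple path between the ends of \<^term>\<open>e\<close> that avoids \<^term>\<open>e\<close> closes up to a cycle. Since the ends are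
  different the path is nonempty, which gives the cycle length at least two, as for parallel edges.
  The edges of the path are distinct because an edge determines the two vertices it joins.\<close>
lemma cycle_through_closure_edge:
  assumes "e \<in> edges G" and "card (ends G e) = 2"
    and "e \<in> graphic_closure (ends G) (edges G - {e})"
  shows "\<exists>vs es. graph_cycle G vs es"
proof -
  obtain u v where e: "ends G e = {u, v}" and "linked (ends G) (edges G - {e}) u v"
    using assms(3) by (auto simp: graphic_closure_def)
  then obtain vs es where p: "length vs = Suc (length es)" "distinct vs" "set es \<subseteq> edges G - {e}"
      "\<And>i. i < length es \<Longrightarrow> ends G (es ! i) = {vs ! i, vs ! Suc i}"
      "vs ! 0 = u" "vs ! length es = v"
    using linked_imp_simple_path by metis
  have "u \<noteq> v"
    using assms(2) e by auto
  then have ne: "es \<noteq> []"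
    using p by auto
  have "distinct es"
    unfolding distinct_conv_nth
  proof (intro allI impI notI)
    fix i j
    assume ij: "i < length es" "j < length es" "i \<noteq> j" "es ! i = es ! j"
    then have "{vs ! i, vs ! Suc i} = {vs ! j, vs ! Suc j}"
      using p(4) by metis
    then show False
      using ij p(1,2) by (auto simp: doubleton_eq_iff nth_eq_iff_index_eq)
  qed
  moreover have "Suc i mod Suc (length es) = Suc i" if "i < length es" for i
    using that by (intro mod_less) simp
  ultimately have "graph_cycle G vs (es @ [e])"
    using p ne e assms(1)
    by (auto simp: graph_cycle_def nth_append less_Suc_eq Suc_le_eq)
  then show ?thesis by blast
qed

text \<open>In a connected graph an edge set connects all vertices exactly when it joins the ends of every
  edge, and it has no cycle exactly when no edge of it is spanned by the others.\<close>
lemma spanning_trees_eq_bases: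
  assumes G: "finite_multigraph G" and conn: "graph_connected G"
  shows "spanning_trees G = {\<gamma>. graphic_basis (ends G) (edges G) \<gamma>}"
proof -
  have ends: "ends G e \<subseteq> verts G" "card (ends G e) = 2" if "e \<in> edges G" for e
    using G that by (auto simp: finite_multigraph_def)
  have "graph_tree (G\<lparr>edges := \<gamma>\<rparr>) \<longleftrightarrow> graphic_basis (ends G) (edges G) \<gamma>" if "\<gamma> \<subseteq> edges G" for \<gamma>
  proof -
    let ?T = "G\<lparr>edges := \<gamma>\<rparr>"
    have V: "verts G \<noteq> {}" and link: "\<And>u v. u \<in> verts G \<Longrightarrow> v \<in> verts G \<Longrightarrow>
        linked (ends G) (edges G) u v"
      using conn graph_connected_iff_linked[of G] ends by auto
    have "graph_connected ?T \<longleftrightarrow> (\<forall>u\<in>verts G. \<forall>v\<in>verts G. linked (ends G) \<gamma> u v)"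
      using graph_connected_iff_linked[of ?T] V ends that by auto
    also have "\<dots> \<longleftrightarrow> edges G \<subseteq> graphic_closure (ends G) \<gamma>"
    proof
      assume *: "\<forall>u\<in>verts G. \<forall>v\<in>verts G. linked (ends G) \<gamma> u v"
      show "edges G \<subseteq> graphic_closure (ends G) \<gamma>"
      proof
        fix e assume "e \<in> edges G"
        from ends[OF this] obtain u v where "ends G e = {u, v}" "u \<in> verts G" "v \<in> verts G"
          by (auto simp: card_2_iff)
        with * show "e \<in> graphic_closure (ends G) \<gamma>"
          by (simp add: graphic_closure_iff)
      qed
    next
      assume *: "edges G \<subseteq> graphic_closure (ends G) \<gamma>"
      show "\<forall>u\<in>verts G. \<forall>v\<in>verts G. linked (ends G) \<gamma> u v"
        by (intro ballI linked_of_subset_closure[OF *] link)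
    qed
    finally have c: "graph_connected ?T \<longleftrightarrow> edges G \<subseteq> graphic_closure (ends G) \<gamma>" .
    have "(\<exists>vs es. graph_cycle ?T vs es) \<longleftrightarrow> (\<exists>e\<in>\<gamma>. e \<in> graphic_closure (ends G) (\<gamma> - {e}))"
    proof
      assume "\<exists>vs es. graph_cycle ?T vs es"
      then obtain vs es where cyc: "graph_cycle ?T vs es" by blast
      then have "es ! 0 \<in> set es" "set es \<subseteq> \<gamma>"
        by (auto simp: graph_cycle_def intro!: nth_mem)
      then have "es ! 0 \<in> \<gamma>"
        by blast
      then show "\<exists>e\<in>\<gamma>. e \<in> graphic_closure (ends G) (\<gamma> - {e})"
        using cycle_edge_in_closure[OF cyc] by auto
    next
      assume "\<exists>e\<in>\<gamma>. e \<in> graphic_closure (ends G) (\<gamma> - {e})"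
      then show "\<exists>vs es. graph_cycle ?T vs es"
        using cycle_through_closure_edge[of _ ?T] ends that by auto
    qed
    with c that show ?thesis
      unfolding graph_tree_def graphic_basis_def by blast
  qed
  then show ?thesis
    unfolding spanning_trees_def by (auto simp: graphic_basis_def)
qed

section \<open>Edge usage and expected overlap\<close>

lemma finite_spanning_trees: "finite_multigraph G \<Longrightarrow> finite (spanning_trees G)"
  by (rule finite_subset[of _ "Pow (edges G)"]) (auto simp: spanning_trees_def finite_multigraph_def)

lemma spanning_tree_subset: "\<gamma> \<in> spanning_trees G \<Longrightarrow> \<gamma> \<subseteq> edges G"
  by (simp add: spanning_trees_def)

lemma sum_pmf_spanning_trees:
  assumes "finite_multigraph G" and "\<mu> \<in> tree_pmfs G"
  shows "(\<Sum>\<gamma>\<in>spanning_trees G. pmf \<mu> \<gamma>) = 1"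
  using assms by (intro sum_pmf_eq_1) (auto simp: finite_spanning_trees tree_pmfs_def)

lemma edge_usage_of_bool:
  assumes "finite_multigraph G"
  shows "edge_usage G \<mu> e = (\<Sum>\<gamma>\<in>spanning_trees G. of_bool (e \<in> \<gamma>) * pmf \<mu> \<gamma>)"
proof -
  have "spanning_trees G \<inter> {\<gamma>. e \<in> \<gamma>} = {\<gamma> \<in> spanning_trees G. e \<in> \<gamma>}"
    by blast
  then show ?thesis
    using finite_spanning_trees[OF assms]
    by (simp add: edge_usage_def of_bool_def if_distrib[of "\<lambda>x. x * _"] sum.If_cases)
qed

lemma edge_usage_nonneg: "edge_usage G \<mu> e \<ge> 0"
  unfolding edge_usage_def by (intro sum_nonneg) simp

lemma edge_usage_eq_prob:
  assumes "finite_multigraph G" and "\<mu> \<in> tree_pmfs G"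
  shows "edge_usage G \<mu> e = measure_pmf.prob \<mu> {\<gamma>. e \<in> \<gamma>}"
proof -
  have "edge_usage G \<mu> e = measure_pmf.prob \<mu> {\<gamma>. \<gamma> \<in> spanning_trees G \<and> e \<in> \<gamma>}"
    using finite_spanning_trees[OF assms(1)]
    by (simp add: edge_usage_def measure_measure_pmf_finite)
  also have "\<dots> = measure_pmf.prob \<mu> {\<gamma>. e \<in> \<gamma>}"
    using assms(2) by (intro measure_eq_AE) (auto simp: AE_measure_pmf_iff tree_pmfs_def)
  finally show ?thesis .
qed

text \<open>Both sides are the expected \<^term>\<open>w\<close>-weight of a random spanning tree.\<close>
lemma sum_weighted_edge_usage:
  assumes G: "finite_multigraph G"
  shows "(\<Sum>e\<in>edges G. w e * edge_usage G \<mu> e) = (\<Sum>\<gamma>\<in>spanning_trees G. pmf \<mu> \<gamma> * (\<Sum>e\<in>\<gamma>. w e))"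
proof -
  have fin: "finite (edges G)"
    using G by (simp add: finite_multigraph_def)
  have "(\<Sum>e\<in>edges G. w e * edge_usage G \<mu> e) =
      (\<Sum>\<gamma>\<in>spanning_trees G. \<Sum>e\<in>edges G. w e * (of_bool (e \<in> \<gamma>) * pmf \<mu> \<gamma>))"
    unfolding edge_usage_of_bool[OF G] sum_distrib_left by (rule sum.swap)
  also have "\<dots> = (\<Sum>\<gamma>\<in>spanning_trees G. pmf \<mu> \<gamma> * (\<Sum>e\<in>\<gamma>. w e))"
  proof (rule sum.cong[OF refl])
    fix \<gamma> assume "\<gamma> \<in> spanning_trees G"
    then have "edges G \<inter> \<gamma> = \<gamma>"
      using spanning_tree_subset by blast
    then have "(\<Sum>e\<in>\<gamma>. w e) = (\<Sum>e\<in>edges G. if e \<in> \<gamma> then w e else 0)"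
      using sum.inter_restrict[OF fin, of w \<gamma>] by simp
    then have "pmf \<mu> \<gamma> * (\<Sum>e\<in>\<gamma>. w e) = (\<Sum>e\<in>edges G. pmf \<mu> \<gamma> * (if e \<in> \<gamma> then w e else 0))"
      by (simp only: sum_distrib_left)
    then show "(\<Sum>e\<in>edges G. w e * (of_bool (e \<in> \<gamma>) * pmf \<mu> \<gamma>)) = pmf \<mu> \<gamma> * (\<Sum>e\<in>\<gamma>. w e)"
      by (auto intro: sum.cong)
  qed
  finally show ?thesis .
qed

text \<open>Two independent random trees both use \<^term>\<open>e\<close> with probability \<^term>\<open>(edge_usage G \<mu> e)\<^sup>2\<close>. Hence
  minimizing the overlap means finding the shortest vector among the usage vectors, which form
  the convex hull of the indicator vectors of the spanning trees.\<close>
lemma expected_overlap_eq_sum_squares: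
  assumes G: "finite_multigraph G"
  shows "expected_overlap G \<mu> = (\<Sum>e\<in>edges G. (edge_usage G \<mu> e)\<^sup>2)"
proof -
  have fin: "finite (edges G)"
    using G by (simp add: finite_multigraph_def)
  have "(\<Sum>e\<in>edges G. (edge_usage G \<mu> e)\<^sup>2) = (\<Sum>\<gamma>\<in>spanning_trees G. pmf \<mu> \<gamma> * (\<Sum>e\<in>\<gamma>. edge_usage G \<mu> e))"
    unfolding power2_eq_square by (rule sum_weighted_edge_usage[OF G])
  also have "\<dots> = expected_overlap G \<mu>"
    unfolding expected_overlap_def
  proof (rule sum.cong[OF refl])
    fix \<gamma> assume \<gamma>: "\<gamma> \<in> spanning_trees G"
    then have "finite \<gamma>"
      using spanning_tree_subset fin finite_subset by blast
    then have card: "real (card (\<gamma> \<inter> \<gamma>')) = (\<Sum>e\<in>\<gamma>. of_bool (e \<in> \<gamma>'))" for \<gamma>'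
      by (simp add: of_bool_def sum.If_cases)
    have "(\<Sum>e\<in>\<gamma>. edge_usage G \<mu> e) =
        (\<Sum>\<gamma>'\<in>spanning_trees G. \<Sum>e\<in>\<gamma>. of_bool (e \<in> \<gamma>') * pmf \<mu> \<gamma>')"
      unfolding edge_usage_of_bool[OF G] by (rule sum.swap)
    also have "\<dots> = (\<Sum>\<gamma>'\<in>spanning_trees G. real (card (\<gamma> \<inter> \<gamma>')) * pmf \<mu> \<gamma>')"
      by (simp add: card sum_distrib_right)
    finally show "pmf \<mu> \<gamma> * (\<Sum>e\<in>\<gamma>. edge_usage G \<mu> e) =
        (\<Sum>\<gamma>'\<in>spanning_trees G. real (card (\<gamma> \<inter> \<gamma>')) * pmf \<mu> \<gamma> * pmf \<mu> \<gamma>')"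
      by (simp add: sum_distrib_left mult_ac)
  qed
  finally show ?thesis by simp
qed

lemma optimal_pmf_iff:
  assumes G: "finite_multigraph G"
  shows "optimal_pmf G \<mu> \<longleftrightarrow> \<mu> \<in> tree_pmfs G \<and>
    (\<forall>\<nu>\<in>tree_pmfs G. expected_overlap G \<mu> \<le> expected_overlap G \<nu>)"
proof -
  have "bdd_below (expected_overlap G ` tree_pmfs G)"
    by (rule bdd_belowI[of _ 0]) (auto simp: expected_overlap_eq_sum_squares[OF G] sum_nonneg)
  then have "MEO G \<le> expected_overlap G \<nu>" if "\<nu> \<in> tree_pmfs G" for \<nu>
    using that unfolding MEO_def by (intro cINF_lower)
  moreover have "MEO G = expected_overlap G \<mu>"
    if "\<mu> \<in> tree_pmfs G" "\<forall>\<nu>\<in>tree_pmfs G. expected_overlap G \<mu> \<le> expected_overlap G \<nu>"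
    using that unfolding MEO_def by (intro cInf_eq_minimum) auto
  ultimately show ?thesis
    unfolding optimal_pmf_def by metis
qed

section \<open>Optimal distributions\<close>

lemma tree_pmf_of_weights:
  fixes f :: "'e set \<Rightarrow> real"
  assumes G: "finite_multigraph G" and nonneg: "\<And>\<gamma>. 0 \<le> f \<gamma>"
    and supp: "\<And>\<gamma>. \<gamma> \<notin> spanning_trees G \<Longrightarrow> f \<gamma> = 0"
    and sum: "(\<Sum>\<gamma>\<in>spanning_trees G. f \<gamma>) = 1"
  obtains \<mu> where "\<mu> \<in> tree_pmfs G" and "\<And>\<gamma>. pmf \<mu> \<gamma> = f \<gamma>"
proof -
  have "(\<integral>\<^sup>+\<gamma>. ennreal (f \<gamma>) \<partial>count_space UNIV) = (\<Sum>\<gamma>\<in>spanning_trees G. ennreal (f \<gamma>))"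
    using finite_spanning_trees[OF G] supp by (intro nn_integral_count_space') auto
  also have "\<dots> = 1"
    using nonneg sum by simp
  finally have "\<And>\<gamma>. pmf (embed_pmf f) \<gamma> = f \<gamma>"
    using nonneg by (intro pmf_embed_pmf)
  then show ?thesis
    using supp by (intro that[of "embed_pmf f"]) (auto simp: tree_pmfs_def set_pmf_eq)
qed

text \<open>The overlap is a continuous function on the compact simplex of all weight functions on the
  spanning trees.\<close>
lemma optimal_pmf_exists:
  assumes G: "finite_multigraph G" and ne: "spanning_trees G \<noteq> {}"
  shows "\<exists>\<mu>. optimal_pmf G \<mu>"
proof -
  let ?T = "spanning_trees G"
  \<comment> \<open>Weights are total functions; fixing them to be zero off the trees makes the product compact.\<close>
  let ?box = "PiE UNIV (\<lambda>\<gamma>. if \<gamma> \<in> ?T then {0..1} else {0}) :: ('b set \<Rightarrow> real) set"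
  define K where "K = ?box \<inter> {f. sum f ?T = 1}"
  define overlap where
    "overlap f = (\<Sum>\<gamma>\<in>?T. \<Sum>\<gamma>'\<in>?T. real (card (\<gamma> \<inter> \<gamma>')) * f \<gamma> * f \<gamma>')" for f :: "'b set \<Rightarrow> real"
  have fin: "finite ?T"
    using G by (rule finite_spanning_trees)
  have "compactin (product_topology (\<lambda>_. euclidean) UNIV) ?box"
    by (auto simp: compactin_PiE)
  then have "compact ?box"
    by (simp add: euclidean_product_topology)
  moreover have "closed {f. sum f ?T = (1 :: real)}"
    by (intro closed_Collect_eq continuous_intros continuous_on_sum continuous_on_product_coordinates)
  ultimately have compact: "compact K"
    unfolding K_def by (rule compact_Int_closed)
  have pmf_in_K: "pmf \<nu> \<in> K" if "\<nu> \<in> tree_pmfs G" for \<nu>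
    using that sum_pmf_spanning_trees[OF G that]
    by (auto simp: K_def tree_pmfs_def pmf_le_1 pmf_eq_0_set_pmf)
  obtain \<gamma> where "\<gamma> \<in> ?T"
    using ne by blast
  then have "return_pmf \<gamma> \<in> tree_pmfs G"
    by (simp add: tree_pmfs_def)
  then have "K \<noteq> {}"
    using pmf_in_K by blast
  moreover have "continuous_on K overlap"
    unfolding overlap_def
    by (intro continuous_intros continuous_on_subset[OF continuous_on_product_coordinates]) auto
  ultimately obtain f where f: "f \<in> K" "\<And>g. g \<in> K \<Longrightarrow> overlap f \<le> overlap g"
    using continuous_attains_inf[OF compact] by blast
  have range: "f \<gamma> \<in> (if \<gamma> \<in> ?T then {0..1} else {0})" for \<gamma>
    using f(1) by (auto simp: K_def PiE_iff)
  then have "0 \<le> f \<gamma>" "\<gamma> \<notin> ?T \<Longrightarrow> f \<gamma> = 0" for \<gamma>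
    by (metis atLeastAtMost_iff order_refl singletonD) (metis range singletonD)
  moreover have "sum f ?T = 1"
    using f(1) by (simp add: K_def)
  ultimately obtain \<mu> where \<mu>: "\<mu> \<in> tree_pmfs G" "\<And>\<gamma>. pmf \<mu> \<gamma> = f \<gamma>"
    using tree_pmf_of_weights[OF G] by metis
  then have "pmf \<mu> = f" by auto
  then have "expected_overlap G \<mu> \<le> expected_overlap G \<nu>" if "\<nu> \<in> tree_pmfs G" for \<nu>
    using f(2)[OF pmf_in_K[OF that]] by (simp add: expected_overlap_def overlap_def)
  with \<mu>(1) show ?thesis
    using optimal_pmf_iff[OF G] by blast
qed

text \<open>The first-order condition for the shortest usage vector \<open>\<eta>\<close>: the half-space
  \<open>\<langle>\<eta>, \<theta>\<rangle> \<ge> \<langle>\<eta>, \<eta>\<rangle>\<close> contains every usage vector \<open>\<theta>\<close>, since otherwise a short step from \<open>\<eta>\<close>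
  towards \<open>\<theta>\<close> would decrease the norm.\<close>
lemma optimal_edge_usage_variational:
  assumes G: "finite_multigraph G" and \<mu>: "optimal_pmf G \<mu>" and \<nu>: "\<nu> \<in> tree_pmfs G"
  shows "(\<Sum>e\<in>edges G. (edge_usage G \<mu> e)\<^sup>2) \<le> (\<Sum>e\<in>edges G. edge_usage G \<mu> e * edge_usage G \<nu> e)"
proof (rule ccontr)
  let ?\<eta> = "edge_usage G \<mu>"
  define \<delta> where "\<delta> e = edge_usage G \<nu> e - ?\<eta> e" for e
  define a D where "a = - (\<Sum>e\<in>edges G. ?\<eta> e * \<delta> e)" and "D = (\<Sum>e\<in>edges G. (\<delta> e)\<^sup>2)"
  assume "\<not> ?thesis"
  then have a: "a > 0"
    by (simp add: a_def \<delta>_def algebra_simps sum_subtractf power2_eq_square)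
  have D: "D \<ge> 0"
    by (simp add: D_def sum_nonneg)
  \<comment> \<open>Moving by \<^term>\<open>t\<close> changes the overlap by \<^term>\<open>t * (t * D - 2 * a)\<close>, which is negative when \<^term>\<open>t * D \<le> a\<close>; the summand one only avoids division by zero.\<close>
  define t where "t = min 1 (a / (D + 1))"
  have t: "0 < t" "t \<le> 1" "t \<le> a / (D + 1)"
    using a D by (auto simp: t_def)
  have \<mu>_tree: "\<mu> \<in> tree_pmfs G"
    using \<mu> by (simp add: optimal_pmf_def)
  define f where "f \<gamma> = (1 - t) * pmf \<mu> \<gamma> + t * pmf \<nu> \<gamma>" for \<gamma>
  have "0 \<le> f \<gamma>" for \<gamma>
    using t by (simp add: f_def)
  moreover have "f \<gamma> = 0" if "\<gamma> \<notin> spanning_trees G" for \<gamma>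
  proof -
    have "\<gamma> \<notin> set_pmf \<mu>" "\<gamma> \<notin> set_pmf \<nu>"
      using that \<mu>_tree \<nu> by (auto simp: tree_pmfs_def)
    then show ?thesis
      by (simp add: f_def set_pmf_eq)
  qed
  moreover have "(\<Sum>\<gamma>\<in>spanning_trees G. f \<gamma>) = 1"
    unfolding f_def
    by (simp add: sum.distrib sum_pmf_spanning_trees[OF G \<mu>_tree] sum_pmf_spanning_trees[OF G \<nu>]
        flip: sum_distrib_left)
  ultimately obtain \<kappa> where \<kappa>: "\<kappa> \<in> tree_pmfs G" "\<And>\<gamma>. pmf \<kappa> \<gamma> = f \<gamma>"
    using tree_pmf_of_weights[OF G] by metis
  have "edge_usage G \<kappa> e = ?\<eta> e + t * \<delta> e" for e
  proof -
    have "edge_usage G \<kappa> e = (1 - t) * ?\<eta> e + t * edge_usage G \<nu> e"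
      unfolding edge_usage_def \<kappa>(2) f_def by (simp only: sum.distrib sum_distrib_left)
    then show ?thesis
      by (simp add: \<delta>_def algebra_simps)
  qed
  then have "expected_overlap G \<kappa> = (\<Sum>e\<in>edges G. (?\<eta> e)\<^sup>2 + 2 * t * (?\<eta> e * \<delta> e) + t\<^sup>2 * (\<delta> e)\<^sup>2)"
    unfolding expected_overlap_eq_sum_squares[OF G]
    by (intro sum.cong) (auto simp: power2_eq_square algebra_simps)
  also have "\<dots> = expected_overlap G \<mu> + t * (t * D - 2 * a)"
    unfolding expected_overlap_eq_sum_squares[OF G] a_def D_def sum.distrib
      sum_distrib_left[symmetric] by (simp add: power2_eq_square algebra_simps)
  finally have eq: "expected_overlap G \<kappa> = expected_overlap G \<mu> + t * (t * D - 2 * a)" .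
  have "t * D \<le> t * (D + 1)"
    using t by simp
  also have "\<dots> \<le> a"
    using t(3) D by (simp add: pos_le_divide_eq)
  finally have "t * (t * D - 2 * a) < 0"
    using a t(1) by (intro mult_pos_neg) auto
  with eq show False
    using \<mu> \<kappa>(1) by (force simp: optimal_pmf_iff[OF G])
qed

text \<open>Two shortest vectors \<open>\<eta>\<close> and \<open>\<theta>\<close> satisfy \<open>\<langle>\<eta>, \<theta>\<rangle> \<ge> \<langle>\<eta>, \<eta>\<rangle> = \<langle>\<theta>, \<theta>\<rangle>\<close>, which makes their distance
  zero.\<close>
lemma optimal_edge_usage_unique:
  assumes G: "finite_multigraph G" and \<mu>: "optimal_pmf G \<mu>" and \<nu>: "optimal_pmf G \<nu>"
    and e: "e \<in> edges G"
  shows "edge_usage G \<nu> e = edge_usage G \<mu> e"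
proof -
  let ?\<eta> = "edge_usage G \<mu>" and ?\<theta> = "edge_usage G \<nu>"
  have fin: "finite (edges G)"
    using G by (simp add: finite_multigraph_def)
  have "(\<Sum>e\<in>edges G. (?\<eta> e)\<^sup>2) \<le> (\<Sum>e\<in>edges G. ?\<eta> e * ?\<theta> e)"
    using \<nu> by (intro optimal_edge_usage_variational[OF G \<mu>]) (simp add: optimal_pmf_def)
  moreover have "(\<Sum>e\<in>edges G. (?\<eta> e)\<^sup>2) = (\<Sum>e\<in>edges G. (?\<theta> e)\<^sup>2)"
    using \<mu> \<nu> by (simp add: optimal_pmf_def flip: expected_overlap_eq_sum_squares[OF G])
  moreover have "(\<Sum>e\<in>edges G. (?\<theta> e - ?\<eta> e)\<^sup>2) = (\<Sum>e\<in>edges G. (?\<theta> e)\<^sup>2)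
      + (\<Sum>e\<in>edges G. (?\<eta> e)\<^sup>2) - 2 * (\<Sum>e\<in>edges G. ?\<eta> e * ?\<theta> e)"
    by (simp add: power2_diff sum.distrib sum_subtractf sum_distrib_left mult_ac)
  ultimately have "(\<Sum>e\<in>edges G. (?\<theta> e - ?\<eta> e)\<^sup>2) \<le> 0"
    by linarith
  then have "(\<Sum>e\<in>edges G. (?\<theta> e - ?\<eta> e)\<^sup>2) = 0"
    by (simp add: antisym sum_nonneg)
  with fin e show ?thesis
    by (simp add: sum_nonneg_eq_0_iff)
qed

text \<open>The first-order condition, applied to point masses, bounds the weight of every spanning tree
  from below by the squared norm of the optimal usage. This bound is also the average tree weight
  under any optimal distribution, so every tree in its support attains the bound.\<close>
lemma fair_tree_minimizes_usage:
  assumes G: "finite_multigraph G" and \<mu>: "optimal_pmf G \<mu>"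
    and \<gamma>: "fair_tree G \<gamma>" and \<gamma>': "\<gamma>' \<in> spanning_trees G"
  shows "(\<Sum>e\<in>\<gamma>. edge_usage G \<mu> e) \<le> (\<Sum>e\<in>\<gamma>'. edge_usage G \<mu> e)"
proof -
  let ?w = "\<lambda>\<tau>. \<Sum>e\<in>\<tau>. edge_usage G \<mu> e" and ?N = "\<Sum>e\<in>edges G. (edge_usage G \<mu> e)\<^sup>2"
  have le: "?N \<le> ?w \<tau>" if \<tau>: "\<tau> \<in> spanning_trees G" for \<tau>
  proof -
    have r: "return_pmf \<tau> \<in> tree_pmfs G"
      using \<tau> by (simp add: tree_pmfs_def)
    have "(\<Sum>e\<in>edges G. edge_usage G \<mu> e * edge_usage G (return_pmf \<tau>) e) = ?w \<tau>"
      unfolding sum_weighted_edge_usage[OF G]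
      using \<tau> finite_spanning_trees[OF G]
      by (subst sum.remove[OF _ \<tau>]) (auto intro!: sum.neutral)
    with optimal_edge_usage_variational[OF G \<mu> r] show ?thesis
      by simp
  qed
  obtain \<nu> where \<nu>: "optimal_pmf G \<nu>" "pmf \<nu> \<gamma> > 0" and \<gamma>_tree: "\<gamma> \<in> spanning_trees G"
    using \<gamma> by (auto simp: fair_tree_def)
  then have "\<nu> \<in> tree_pmfs G"
    by (simp add: optimal_pmf_def)
  have "(\<Sum>\<tau>\<in>spanning_trees G. pmf \<nu> \<tau> * (?w \<tau> - ?N)) =
      (\<Sum>\<tau>\<in>spanning_trees G. pmf \<nu> \<tau> * ?w \<tau>) - ?N"
    using sum_pmf_spanning_trees[OF G \<open>\<nu> \<in> tree_pmfs G\<close>]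
    by (simp add: right_diff_distrib sum_subtractf flip: sum_distrib_right)
  also have "(\<Sum>\<tau>\<in>spanning_trees G. pmf \<nu> \<tau> * ?w \<tau>) = ?N"
    using optimal_edge_usage_unique[OF G \<mu> \<nu>(1)]
    by (simp add: power2_eq_square flip: sum_weighted_edge_usage[OF G])
  finally have "(\<Sum>\<tau>\<in>spanning_trees G. pmf \<nu> \<tau> * (?w \<tau> - ?N)) = 0"
    by simp
  moreover have "0 \<le> pmf \<nu> \<tau> * (?w \<tau> - ?N)" if "\<tau> \<in> spanning_trees G" for \<tau>
    using le[OF that] by simp
  ultimately have "pmf \<nu> \<gamma> * (?w \<gamma> - ?N) = 0"
    using \<gamma>_tree finite_spanning_trees[OF G] by (simp add: sum_nonneg_eq_0_iff)
  then have "?w \<gamma> = ?N"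
    using \<nu>(2) by simp
  with le[OF \<gamma>'] show ?thesis
    by simp
qed

text \<open>All usage vectors of \<^term>\<open>H\<close> have the same coordinate sum, because all spanning trees have the same
  number of edges. Among vectors with a given sum the constant one is the shortest, with excess
  equal to the squared distance from it.\<close>
lemma homogeneous_if_constant_usage:
  assumes H: "finite_multigraph H" and conn: "graph_connected H"
    and \<nu>: "\<nu> \<in> tree_pmfs H" and const: "\<And>e. e \<in> edges H \<Longrightarrow> edge_usage H \<nu> e = c"
  shows "homogeneous H"
proof -
  have fin: "finite (edges H)"
    using H by (simp add: finite_multigraph_def)
  obtain n where n: "\<And>\<gamma>. \<gamma> \<in> spanning_trees H \<Longrightarrow> card \<gamma> = n"
    using card_graphic_basis_unique[OF fin] spanning_trees_eq_bases[OF H conn]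
    by (metis mem_Collect_eq)
  have total: "(\<Sum>e\<in>edges H. edge_usage H \<kappa> e) = real n" if "\<kappa> \<in> tree_pmfs H" for \<kappa>
  proof -
    have "(\<Sum>e\<in>edges H. 1 * edge_usage H \<kappa> e) = (\<Sum>\<gamma>\<in>spanning_trees H. pmf \<kappa> \<gamma> * real n)"
      unfolding sum_weighted_edge_usage[OF H] using n by (intro sum.cong) auto
    then show ?thesis
      using sum_pmf_spanning_trees[OF H that] by (simp flip: sum_distrib_right)
  qed
  have excess: "expected_overlap H \<kappa> = expected_overlap H \<nu> + (\<Sum>e\<in>edges H. (edge_usage H \<kappa> e - c)\<^sup>2)"
    if "\<kappa> \<in> tree_pmfs H" for \<kappa>
  proof -
    have "(\<Sum>e\<in>edges H. (edge_usage H \<kappa> e - c)\<^sup>2) =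
        (\<Sum>e\<in>edges H. (edge_usage H \<kappa> e)\<^sup>2 + c\<^sup>2 - 2 * c * edge_usage H \<kappa> e)"
      by (intro sum.cong) (auto simp: power2_diff)
    also have "\<dots> = expected_overlap H \<kappa> + real (card (edges H)) * c\<^sup>2 - 2 * c * real n"
      unfolding sum.distrib sum_subtractf sum_distrib_left[symmetric] total[OF that]
      by (simp add: expected_overlap_eq_sum_squares[OF H])
    finally have "(\<Sum>e\<in>edges H. (edge_usage H \<kappa> e - c)\<^sup>2) =
        expected_overlap H \<kappa> + real (card (edges H)) * c\<^sup>2 - 2 * c * real n" .
    moreover have "expected_overlap H \<nu> = real (card (edges H)) * c\<^sup>2"
      using const by (simp add: expected_overlap_eq_sum_squares[OF H])
    moreover have "real n = real (card (edges H)) * c"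
      using const total[OF \<nu>] by simp
    then have "2 * c * real n = 2 * (real (card (edges H)) * c\<^sup>2)"
      by (simp add: power2_eq_square)
    ultimately show ?thesis
      by linarith
  qed
  have "expected_overlap H \<nu> \<le> expected_overlap H \<kappa>" if "\<kappa> \<in> tree_pmfs H" for \<kappa>
    unfolding excess[OF that] by (simp add: sum_nonneg)
  with \<nu> have opt: "optimal_pmf H \<nu>"
    by (simp add: optimal_pmf_iff[OF H])
  have "edge_usage H \<kappa> e = c" if "optimal_pmf H \<kappa>" "e \<in> edges H" for \<kappa> e
    using optimal_edge_usage_unique[OF H opt that] const[OF that(2)] by simp
  then have "\<forall>\<kappa>. optimal_pmf H \<kappa> \<longrightarrow> (\<forall>e\<in>edges H. edge_usage H \<kappa> e = c)"
    by simp
  with opt show ?thesis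
    unfolding homogeneous_def by (intro conjI exI)
qed

section \<open>The homogeneous core\<close>

text \<open>A route of \<^term>\<open>L\<close> that starts in the component of \<^term>\<open>x\<close> never leaves it.\<close>
lemma linked_within_component:
  assumes "linked d F u v" and "linked d L x u" and "F \<subseteq> L"
  shows "linked d {e \<in> F. d e \<subseteq> {y. linked d L x y}} u v"
  using assms(1)
proof (induction rule: linked_induct)
  case (step v w e)
  have "linked d L x v"
    using assms step.hyps(1) by (blast intro: linked_trans linked_mono)
  moreover have "linked d L v w"
    using step.hyps(2,3) assms(3) by (blast intro: linked_edge)
  ultimately have "linked d L x w"
    by (rule linked_trans)
  with \<open>linked d L x v\<close> have "e \<in> {e \<in> F. d e \<subseteq> {y. linked d L x y}}"
    using step.hyps(2,3) by auto
  then show ?case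
    using step.hyps(3) step.IH by (blast intro: linked_trans linked_edge)
qed simp

text \<open>The greedy principle at the lowest weight \<^term>\<open>m\<close>; \<^term>\<open>K\<close> consists of the edges of one connected
  component of the graph of lightest edges. If \<^term>\<open>B\<close> did not span \<^term>\<open>e \<in> K\<close> inside \<^term>\<open>K\<close>, then the path
  of \<^term>\<open>B\<close> between the ends of \<^term>\<open>e\<close> would use a heavier edge, and swapping that edge for \<^term>\<open>e\<close> would
  give a lighter basis.\<close>
lemma minimum_weight_basis_restricts:
  fixes w :: "'e \<Rightarrow> real" and d :: "'e \<Rightarrow> 'v set" and x :: 'v
  assumes "finite E" and B: "graphic_basis d E B"
    and minimal: "\<And>C. graphic_basis d E C \<Longrightarrow> sum w B \<le> sum w C"
    and low: "\<And>e. e \<in> E \<Longrightarrow> m \<le> w e"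
  defines "L \<equiv> {e \<in> E. w e = m}"
  defines "K \<equiv> {e \<in> L. d e \<subseteq> {y. linked d L x y}}"
  shows "graphic_basis d K (B \<inter> K)"
proof -
  have BE: "B \<subseteq> E"
    using B by (simp add: graphic_basis_def)
  then have "finite B"
    using assms(1) finite_subset by blast
  have "e \<in> graphic_closure d (B \<inter> K)" if e: "e \<in> K" for e
  proof -
    have eE: "e \<in> E" "w e = m" "e \<in> graphic_closure d B"
      using e B by (auto simp: K_def L_def graphic_basis_def)
    obtain u v where uv: "d e = {u, v}"
      using eE(3) by (auto simp: graphic_closure_def)
    obtain P where P: "P \<subseteq> B" "e \<in> graphic_closure d P"
        "\<And>f. f \<in> P \<Longrightarrow> e \<notin> graphic_closure d (P - {f})"
      using minimal_subset_with_closure[OF \<open>finite B\<close> eE(3)] by metis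
    show ?thesis
    proof (cases "P \<subseteq> L")
      case True
      have "linked d P u v"
        using P(2) uv by (simp add: graphic_closure_iff)
      moreover have "linked d L x u"
        using e uv by (auto simp: K_def)
      ultimately have "linked d {f \<in> P. d f \<subseteq> {y. linked d L x y}} u v"
        using True by (rule linked_within_component)
      moreover have "{f \<in> P. d f \<subseteq> {y. linked d L x y}} \<subseteq> B \<inter> K"
        using P(1) True by (auto simp: K_def L_def)
      ultimately have "linked d (B \<inter> K) u v"
        by (rule linked_mono[rotated])
      with uv show ?thesis
        by (simp add: graphic_closure_iff)
    next
      case False
      then obtain f where f: "f \<in> P" "f \<notin> L"
        by blast
      have fB: "f \<in> B"
        using f P(1) by blast
      then have "f \<in> graphic_closure d B"
        using B BE by (auto simp: graphic_basis_def)
      then obtain a b where "d f = {a, b}"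
        by (auto simp: graphic_closure_def)
      then have C: "graphic_basis d E (insert e (B - {f}))"
        using graphic_basis_swap[OF B eE(1) P(1,2) P(3)[OF f(1)] f(1)] by blast
      have "m < w f"
        using f fB BE low[of f] by (force simp: L_def)
      show ?thesis
      proof (rule ccontr)
        assume "e \<notin> graphic_closure d (B \<inter> K)"
        moreover have "e \<in> graphic_closure d (B \<inter> K)" if "e \<in> B"
          using that e uv by (auto simp: graphic_closure_iff intro: linked_edge)
        ultimately have "e \<notin> B"
          by blast
        then have "sum w (insert e (B - {f})) = sum w B - w f + w e"
          using \<open>finite B\<close> fB by (simp add: sum_diff1)
        with minimal[OF C] eE(2) \<open>m < w f\<close> show False
          by simp
      qed
    qed
  qed
  moreover have "e \<notin> graphic_closure d (B \<inter> K - {e})" if "e \<in> B \<inter> K" for e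
    using B that graphic_closure_mono[of "B \<inter> K - {e}" "B - {e}" d]
    by (auto simp: graphic_basis_def)
  ultimately show ?thesis
    by (auto simp: graphic_basis_def)
qed

theorem theorem1p2:
  fixes G :: "('v, 'e) multigraph"
  assumes "finite_multigraph G"
    and "graph_connected G"
    and "edges G \<noteq> {}"
  shows "\<exists>H. homogeneous_core H G"
proof -
  note G = assms(1)
  have fin: "finite (verts G)" "finite (edges G)"
    and ends: "\<And>e. e \<in> edges G \<Longrightarrow> ends G e \<subseteq> verts G \<and> card (ends G e) = 2"
    using G by (auto simp: finite_multigraph_def)
  have bases: "spanning_trees G = {\<gamma>. graphic_basis (ends G) (edges G) \<gamma>}"
    by (rule spanning_trees_eq_bases[OF assms(1,2)])
  have "\<exists>u v. ends G e = {u, v}" if "e \<in> edges G" for e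
    using ends[OF that] by (auto simp: card_2_iff)
  then have "spanning_trees G \<noteq> {}"
    using graphic_basis_exists[OF fin(2)] bases by blast
  then obtain \<mu> where \<mu>: "optimal_pmf G \<mu>"
    using optimal_pmf_exists[OF G] by blast
  have \<mu>_tree: "\<mu> \<in> tree_pmfs G"
    using \<mu> by (simp add: optimal_pmf_def)
  let ?\<eta> = "edge_usage G \<mu>"
  define m where "m = Min (?\<eta> ` edges G)"
  have low: "m \<le> ?\<eta> e" if "e \<in> edges G" for e
    using that fin by (simp add: m_def)
  have "m \<in> ?\<eta> ` edges G"
    using fin assms(3) unfolding m_def by (intro Min_in) auto
  then obtain e0 where e0: "e0 \<in> edges G" "?\<eta> e0 = m"
    by blast
  obtain x y where xy: "ends G e0 = {x, y}"
    using ends[OF e0(1)] by (auto simp: card_2_iff)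
  define L where "L = {e \<in> edges G. ?\<eta> e = m}"
  define V where "V = {v. linked (ends G) L x v}"
  define F where "F = {e \<in> L. ends G e \<subseteq> V}"
  define H where "H = \<lparr>verts = V, edges = F, ends = ends G\<rparr>"
  have H_sel: "verts H = V" "edges H = F" "ends H = ends G"
    by (simp_all add: H_def)
  have "v \<in> verts G" if "linked (ends G) L x v" for v
    using that
  proof (induction rule: linked_induct)
    case refl
    show ?case using ends[OF e0(1)] xy by simp
  next
    case (step v w e)
    then show ?case using ends[of e] by (auto simp: L_def)
  qed
  then have VG: "V \<subseteq> verts G"
    by (auto simp: V_def)
  have FG: "F \<subseteq> edges G"
    by (auto simp: F_def L_def)
  have "linked (ends G) L x y"
    using e0 xy by (intro linked_edge[of e0]) (auto simp: L_def)
  then have "e0 \<in> F"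
    using e0 xy by (auto simp: F_def L_def V_def)
  have H: "finite_multigraph H"
    using finite_subset[OF VG fin(1)] finite_subset[OF FG fin(2)] ends
    by (auto simp: finite_multigraph_def H_sel F_def L_def)
  have from_x: "linked (ends G) F x v" if "v \<in> V" for v
  proof -
    have "linked (ends G) {e \<in> L. ends G e \<subseteq> {y. linked (ends G) L x y}} x v"
      using that by (intro linked_within_component) (auto simp: V_def)
    moreover have "{e \<in> L. ends G e \<subseteq> {y. linked (ends G) L x y}} = F"
      by (simp add: F_def V_def)
    ultimately show ?thesis by simp
  qed
  then have linked_H: "linked (ends G) F u v" if "u \<in> V" "v \<in> V" for u v
    using that by (blast intro: linked_trans linked_sym)
  have "x \<in> V"
    by (simp add: V_def)
  then have conn: "graph_connected H"
    using linked_H graph_connected_iff_linked[of H] by (auto simp: H_sel F_def)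
  have trees_H: "spanning_trees H = {\<gamma>. graphic_basis (ends G) F \<gamma>}"
    using spanning_trees_eq_bases[OF H conn] by (simp add: H_sel)
  have restrict: "\<gamma> \<inter> F \<in> spanning_trees H" if "fair_tree G \<gamma>" for \<gamma>
  proof -
    have "graphic_basis (ends G) (edges G) \<gamma>"
      using that bases by (auto simp: fair_tree_def)
    then show ?thesis
      using minimum_weight_basis_restricts[of "edges G" "ends G" \<gamma> ?\<eta> m x]
        fin low fair_tree_minimizes_usage[OF G \<mu> that] bases
      by (simp add: trees_H F_def V_def L_def)
  qed
  have fair: "fair_tree G \<gamma>" if "\<gamma> \<in> set_pmf \<mu>" for \<gamma>
    using that \<mu> \<mu>_tree pmf_positive[OF that] by (auto simp: fair_tree_def tree_pmfs_def)
  have "e \<in> F" if e: "e \<in> edges G" "ends G e \<subseteq> V" for e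
  proof (rule ccontr)
    \<comment> \<open>Such an edge has positive usage, yet a fair tree containing it already joins its ends inside \<^term>\<open>H\<close>.\<close>
    assume "e \<notin> F"
    then have "m < ?\<eta> e"
      using e low[OF e(1)] by (force simp: F_def L_def)
    moreover have "0 \<le> m"
      using e0 edge_usage_nonneg by metis
    ultimately have "measure_pmf.prob \<mu> {\<gamma>. e \<in> \<gamma>} \<noteq> 0"
      by (simp add: edge_usage_eq_prob[OF G \<mu>_tree])
    then obtain \<gamma> where \<gamma>: "\<gamma> \<in> set_pmf \<mu>" "e \<in> \<gamma>"
      by (auto simp: measure_pmf_zero_iff)
    have "F \<subseteq> graphic_closure (ends G) (\<gamma> \<inter> F)"
      using restrict[OF fair[OF \<gamma>(1)]] by (simp add: trees_H graphic_basis_def)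
    moreover obtain u v where uv: "ends G e = {u, v}"
      using ends[OF e(1)] by (auto simp: card_2_iff)
    moreover have "linked (ends G) F u v"
      using uv e(2) by (intro linked_H) auto
    ultimately have "linked (ends G) (\<gamma> \<inter> F) u v"
      by (blast intro: linked_of_subset_closure)
    moreover have "\<gamma> \<inter> F \<subseteq> \<gamma> - {e}"
      using \<open>e \<notin> F\<close> by blast
    ultimately have "linked (ends G) (\<gamma> - {e}) u v"
      by (metis linked_mono)
    moreover have "graphic_basis (ends G) (edges G) \<gamma>"
      using fair[OF \<gamma>(1)] bases by (auto simp: fair_tree_def)
    ultimately show False
      using \<gamma>(2) uv by (auto simp: graphic_basis_def graphic_closure_iff)
  qed
  then have induced: "vertex_induced H G"
    by (simp add: vertex_induced_def H_sel)
  \<comment> \<open>The restriction of a random optimal tree of \<^term>\<open>G\<close> to \<^term>\<open>H\<close> keeps the usage \<^term>\<open>m\<close> of every edge of \<^term>\<open>H\<close>.\<close>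
  define \<nu> where "\<nu> = map_pmf (\<lambda>\<gamma>. \<gamma> \<inter> F) \<mu>"
  have \<nu>_tree: "\<nu> \<in> tree_pmfs H"
    using restrict fair by (auto simp: tree_pmfs_def \<nu>_def)
  have "edge_usage H \<nu> e = m" if "e \<in> edges H" for e
  proof -
    have eF: "e \<in> F"
      using that by (simp add: H_sel)
    then have "(\<lambda>\<gamma>. \<gamma> \<inter> F) -` {\<gamma>. e \<in> \<gamma>} = {\<gamma>. e \<in> \<gamma>}"
      by auto
    then have "measure_pmf.prob \<nu> {\<gamma>. e \<in> \<gamma>} = measure_pmf.prob \<mu> {\<gamma>. e \<in> \<gamma>}"
      by (simp only: \<nu>_def measure_map_pmf)
    then have "edge_usage H \<nu> e = ?\<eta> e"
      by (simp only: edge_usage_eq_prob[OF H \<nu>_tree] edge_usage_eq_prob[OF G \<mu>_tree])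
    then show ?thesis
      using eF by (simp add: F_def L_def)
  qed
  then have "homogeneous H"
    by (rule homogeneous_if_constant_usage[OF H conn \<nu>_tree])
  moreover have "subgraph H G"
    using H VG FG by (simp add: subgraph_def H_sel)
  ultimately have "homogeneous_core H G"
    using conn restrict induced \<open>e0 \<in> F\<close> unfolding homogeneous_core_def H_sel by blast
  then show ?thesis by blast
qed

end
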